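(* Let $\mathcal{A}\in\mathbb{C}^{n\times n\times p}$ be a complex tensor. Then it can be factorized as $$\mathcal{A}=\mathcal{Q}^{-1}*\mathcal{T}*\mathcal{Q},$$ where $\mathcal{Q}\in\mathbb{C}^{n\times n\times p}$ is a unitary tensor and $\mathcal{T}\in\mathbb{C}^{n\times n\times p}$ is an F-upper triangular tensor.
   Context: For $\mathcal{A}\in\mathbb{C}^{m\times n\times p}$ let $A^{(1)},\dots,A^{(p)}\in\mathbb{C}^{m\times n}$ be its frontal slices. $\mathrm{bcirc}(\mathcal{A})$ is the $mp\times np$ block circulant matrix whose $(i,j)$ block ($1\le i,j\le p$) is $A^{(((i-j)\bmod p)+1)}$; $\mathrm{unfold}(\mathcal{A})$ is the $mp\times n$ matrix obtained by stacking $A^{(1)},\dots,A^{(p)}$ vertically, and $\mathrm{fold}$ is the inverse of $\mathrm{unfold}$. The T-product is $\mathcal{A}*\mathcal{B}=\mathrm{fold}(\mathrm{bcirc}(\mathcal{A})\,\mathrm{unfold}(\mathcal{B}))$. The identity tensor $\mathcal{I}$ has first frontal slice $I_n$ and other slices zero; $\mathcal{Q}^{-1}$ is the inverse with respect to $*$ and $\mathcal{I}$. The conjugate transpose $\mathcal{A}^H$ is obtained by conjugate transposing each frontal slice and then reversing the order of the conjugate transposed slices $2$ through $p$ (so $\mathrm{bcirc}(\mathcal{A}^H)=\mathrm{bcirc}(\mathcal{A})^H$). $\mathcal{Q}$ is unitary if $\mathcal{Q}^H*\mathcal{Q}=\mathcal{Q}*\mathcal{Q}^H=\mathcal{I}$.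 A tensor is F-upper triangular if all its frontal slices are upper triangular matrices. *)

theory Defs
  imports "Jordan_Normal_Form.Schur_Decomposition"
begin

text \<open>
  A third-order complex tensor is the list of its frontal slices, so the slice numbered \<open>k\<close> in
  the usual 1-based notation is \<open>A ! (k - 1)\<close>. Two members of \<open>tensor_carrier m n p\<close> are
  equal as lists iff they are equal as tensors.
\<close>

type_synonym tensor = "complex mat list"

definition tensor_carrier :: "nat \<Rightarrow> nat \<Rightarrow> nat \<Rightarrow> tensor set" where
  "tensor_carrier m n p = {A. length A = p \<and> set A \<subseteq> carrier_mat m n}"

definition t_rows :: "tensor \<Rightarrow> nat" where
  "t_rows A = dim_row (hd A)"

definition t_cols :: "tensor \<Rightarrow> nat" where
  "t_cols A = dim_col (hd A)"

text \<open>
  Entry \<open>(i, j)\<close> lies in block \<open>(i div m, j div n)\<close>. As \<open>j div n < p\<close>, adding \<open>p\<close> before subtracting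
  makes the natural number subtraction exact, so the slice index is the cyclic difference of the
  block indices.
\<close>

definition t_bcirc :: "tensor \<Rightarrow> complex mat" where
  "t_bcirc A = (let m = t_rows A; n = t_cols A; p = length A in
     mat (m * p) (n * p) (\<lambda>(i, j).
       (A ! ((i div m + p - j div n) mod p)) $$ (i mod m, j mod n)))"

definition t_unfold :: "tensor \<Rightarrow> complex mat" where
  "t_unfold A = (let m = t_rows A; n = t_cols A; p = length A in
     mat (m * p) n (\<lambda>(i, j). (A ! (i div m)) $$ (i mod m, j)))"

definition t_fold :: "nat \<Rightarrow> nat \<Rightarrow> complex mat \<Rightarrow> tensor" where
  "t_fold m p X = map (\<lambda>k. mat m (dim_col X) (\<lambda>(i, j). X $$ (k * m + i, j))) [0..<p]"

definition t_prod :: "tensor \<Rightarrow> tensor \<Rightarrow> tensor" (infixl "*\<^sub>t" 70) where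
  "A *\<^sub>t B = t_fold (t_rows A) (length A) (t_bcirc A * t_unfold B)"

definition t_one :: "nat \<Rightarrow> nat \<Rightarrow> tensor" where
  "t_one n p = map (\<lambda>k. if k = 0 then 1\<^sub>m n else 0\<^sub>m n n) [0..<p]"

text \<open>The inverse is only meaningful for invertible tensors, in particular for unitary ones.\<close>

definition t_inv :: "nat \<Rightarrow> nat \<Rightarrow> tensor \<Rightarrow> tensor" where
  "t_inv n p Q = (THE R. R \<in> tensor_carrier n n p \<and> R *\<^sub>t Q = t_one n p \<and> Q *\<^sub>t R = t_one n p)"

fun t_adjoint :: "tensor \<Rightarrow> tensor" where
  "t_adjoint [] = []"
| "t_adjoint (B # Bs) = mat_adjoint B # rev (map mat_adjoint Bs)"

definition t_unitary :: "nat \<Rightarrow> nat \<Rightarrow> tensor \<Rightarrow> bool" where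
  "t_unitary n p Q \<longleftrightarrow> Q \<in> tensor_carrier n n p \<and>
     t_adjoint Q *\<^sub>t Q = t_one n p \<and> Q *\<^sub>t t_adjoint Q = t_one n p"

definition F_upper_triangular :: "tensor \<Rightarrow> bool" where
  "F_upper_triangular T \<longleftrightarrow> (\<forall>B\<in>set T. upper_triangular B)"

lemma tensor_carrier_dims:
  assumes "A \<in> tensor_carrier m n p" "0 < p"
  shows "length A = p" "t_rows A = m" "t_cols A = n"
    "\<And>k. k < p \<Longrightarrow> A ! k \<in> carrier_mat m n"
proof -
  show len: "length A = p" using assms by (simp add: tensor_carrier_def)
  show *: "\<And>k. k < p \<Longrightarrow> A ! k \<in> carrier_mat m n"
    using assms len nth_mem by (fastforce simp: tensor_carrier_def)
  have "hd A = A ! 0" using len assms(2) by (cases A) auto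
  then show "t_rows A = m" "t_cols A = n" using *[OF assms(2)] by (auto simp: t_rows_def t_cols_def)
qed

lemma t_fold_unfold:
  assumes "A \<in> tensor_carrier m n p" "0 < p"
  shows "t_fold m p (t_unfold A) = A"
proof (rule nth_equalityI)
  note d = tensor_carrier_dims[OF assms]
  show "length (t_fold m p (t_unfold A)) = length A" by (simp add: t_fold_def d)
  fix k assume "k < length (t_fold m p (t_unfold A))"
  then have k: "k < p" by (simp add: t_fold_def)
  have *: "k * m + i < m * p" if "i < m" for i
  proof -
    have "k * m + i < Suc k * m" using that by simp
    also have "\<dots> \<le> p * m" using k by (intro mult_le_mono1) simp
    finally show ?thesis by (simp add: mult.commute)
  qed
  show "t_fold m p (t_unfold A) ! k = A ! k"
    using k * carrier_matD[OF d(4)[OF k]]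
    by (intro eq_matI) (simp_all add: t_fold_def t_unfold_def d Let_def)
qed

lemma t_adjoint_nth:
  assumes "k < length A"
  shows "t_adjoint A ! k = mat_adjoint (A ! ((length A - k) mod length A))"
proof (cases A)
  case (Cons B Bs)
  show ?thesis
  proof (cases k)
    case (Suc l)
    then have l: "l < length Bs" using assms Cons by simp
    then have "rev (map mat_adjoint Bs) ! l = mat_adjoint (Bs ! (length Bs - Suc l))"
      by (simp add: rev_nth)
    moreover have "(length A - k) mod length A = Suc (length Bs - Suc l)"
      using Cons Suc l by simp
    ultimately show ?thesis using Cons Suc by simp
  qed (simp add: Cons)
qed (use assms in simp)

lemma t_adjoint_carrier:
  assumes "A \<in> tensor_carrier m n p"
  shows "t_adjoint A \<in> tensor_carrier n m p"
proof -
  have "set (t_adjoint A) = mat_adjoint ` set A" by (cases A) simp_all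
  moreover have "length (t_adjoint A) = length A" by (cases A) simp_all
  moreover have "mat_adjoint B \<in> carrier_mat n m" if "B \<in> carrier_mat m n" for B :: "complex mat"
    using carrier_matD[OF that] by (intro carrier_matI) (simp_all add: mat_adjoint_def)
  ultimately show ?thesis using assms by (auto simp: tensor_carrier_def)
qed

lemma t_bcirc_adjoint:
  assumes A: "A \<in> tensor_carrier m n p" and p: "0 < p"
  shows "t_bcirc (t_adjoint A) = mat_adjoint (t_bcirc A)"
proof -
  note d = tensor_carrier_dims[OF A p]
  note d' = tensor_carrier_dims[OF t_adjoint_carrier[OF A] p]
  have adj: "mat_adjoint B $$ (i, j) = cnj (B $$ (j, i))"
    if "i < dim_col B" "j < dim_row B" for B :: "complex mat" and i j
    using that by (simp add: mat_adjoint_def mat_of_rows_def)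
  have dims: "dim_row (mat_adjoint B) = dim_col B" "dim_col (mat_adjoint B) = dim_row B"
    for B :: "complex mat" by (simp_all add: mat_adjoint_def)
  have idx: "(p - (a + p - b) mod p) mod p = (b + p - a) mod p" if "a < p" "b < p" for a b
  proof (cases "a < b")
    case True
    then have "(a + p - b) mod p = a + p - b" using that by (intro mod_less) linarith
    moreover have "(b + p - a) mod p = b - a"
      using that True by (simp add: le_mod_geq)
    moreover have "p - (a + p - b) = b - a" using that True by linarith
    moreover have "b - a < p" using that by linarith
    ultimately show ?thesis by simp
  next
    case False
    then have "a + p - b = (a - b) + p" "a - b < p" using that by linarith+
    then have "(a + p - b) mod p = a - b" by (metis mod_add_self2 mod_less)
    moreover have "p - (a - b) = b + p - a" using that False by linarith
    ultimately show ?thesis by simp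
  qed
  have bnd: "0 < m \<and> i mod m < m \<and> i div m < p" if "i < m * p" for i m
  proof -
    have "0 < m" using that by (cases m) auto
    moreover have "i div m < p"
      using that by (intro less_mult_imp_div_less) (simp add: mult.commute)
    ultimately show ?thesis by simp
  qed
  show ?thesis
  proof (rule eq_matI)
    fix i j assume "i < dim_row (mat_adjoint (t_bcirc A))" "j < dim_col (mat_adjoint (t_bcirc A))"
    then have i: "i < n * p" and j: "j < m * p" by (simp_all add: dims t_bcirc_def d Let_def)
    let ?a = "i div n" and ?b = "j div m"
    let ?k = "(?a + p - ?b) mod p" and ?l = "(?b + p - ?a) mod p"
    have kl: "?k < p" "?l < p" using p by simp_all
    have "t_bcirc (t_adjoint A) $$ (i, j) = (t_adjoint A ! ?k) $$ (i mod n, j mod m)"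
      using i j by (simp add: t_bcirc_def d' Let_def)
    also have "t_adjoint A ! ?k = mat_adjoint (A ! ?l)"
    proof -
      have ab: "?a < p" "?b < p" using bnd[OF i] bnd[OF j] by blast+
      have "?k < length A" using kl(1) unfolding d(1) .
      from t_adjoint_nth[OF this] show ?thesis unfolding d(1) idx[OF ab] .
    qed
    also have "\<dots> $$ (i mod n, j mod m) = cnj ((A ! ?l) $$ (j mod m, i mod n))"
    proof (rule adj)
      show "i mod n < dim_col (A ! ?l)"
        unfolding carrier_matD(2)[OF d(4)[OF kl(2)]] using bnd[OF i] by blast
      show "j mod m < dim_row (A ! ?l)"
        unfolding carrier_matD(1)[OF d(4)[OF kl(2)]] using bnd[OF j] by blast
    qed
    also have "\<dots> = cnj (t_bcirc A $$ (j, i))"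
      using i j by (simp add: t_bcirc_def d Let_def)
    also have "\<dots> = mat_adjoint (t_bcirc A) $$ (i, j)"
      using i j by (subst adj) (simp_all add: t_bcirc_def d Let_def)
    finally show "t_bcirc (t_adjoint A) $$ (i, j) = mat_adjoint (t_bcirc A) $$ (i, j)" .
  qed (simp_all add: dims t_bcirc_def d d' Let_def)
qed

end

theory Submission
  imports Defs
begin

text \<open>
  The T-product is a cyclic convolution of the sequences of frontal slices, so the discrete Fourier
  transform along the third dimension turns it into \<open>p\<close> independent matrix products
  (\<open>t_dft_prod\<close>). The same transform turns the tensor adjoint into the slicewise conjugate
  transpose (\<open>t_dft_adjoint\<close>), because reversing the slices \<open>2, \<dots>, p\<close> cancels the
  conjugation of the roots of unity. It is invertible (\<open>t_idft_dft\<close>, \<open>t_dft_idft\<close>), and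
  so a tensor identity amounts to \<open>p\<close> matrix identities. In particular a tensor is unitary iff all
  slices of its transform are unitary matrices (\<open>t_unitary_iff_dft\<close>).

  Each slice \<open>t_dft A q\<close> is an ordinary complex square matrix and has a Schur form
  \<open>U q * S q * mat_adjoint (U q)\<close> with \<open>U q\<close> unitary and \<open>S q\<close> upper triangular
  (\<open>unitary_schur\<close>). The inverse transforms of the slices \<open>mat_adjoint (U q)\<close> and
  \<open>S q\<close> are the required \<open>Q\<close> and \<open>T\<close>: upper triangular matrices form a linear subspace,
  so every slice of \<open>T\<close>, being a linear combination of the \<open>S q\<close>, is upper triangular. Different
  slices may use unrelated Schur forms, since over the complex numbers nothing ties the slices of
  the transform to each other.
\<close>

section \<open>Conjugate transposes and unitary matrices\<close>

lemma dim_mat_adjoint [simp]: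
  "dim_row (mat_adjoint B) = dim_col B" "dim_col (mat_adjoint B) = dim_row B"
  by (simp_all add: mat_adjoint_def)

lemma mat_adjoint_carrier [simp]:
  "B \<in> carrier_mat m n \<Longrightarrow> mat_adjoint B \<in> carrier_mat n m"
  by (auto intro: carrier_matI)

lemma mat_adjoint_index [simp]:
  "i < dim_col B \<Longrightarrow> j < dim_row B \<Longrightarrow> mat_adjoint B $$ (i, j) = conjugate (B $$ (j, i))"
  by (simp add: mat_adjoint_def mat_of_rows_def)

lemma mat_adjoint_mat_adjoint [simp]: "mat_adjoint (mat_adjoint B) = B"
  by (intro eq_matI) auto

lemma mat_adjoint_mult:
  fixes A B :: "'a :: conjugatable_field mat"
  assumes "A \<in> carrier_mat m n" "B \<in> carrier_mat n r"
  shows "mat_adjoint (A * B) = mat_adjoint B * mat_adjoint A"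
proof (rule eq_matI)
  fix i j assume "i < dim_row (mat_adjoint B * mat_adjoint A)"
    "j < dim_col (mat_adjoint B * mat_adjoint A)"
  then show "mat_adjoint (A * B) $$ (i, j) = (mat_adjoint B * mat_adjoint A) $$ (i, j)"
    using assms
    by (auto simp: scalar_prod_def sum_conjugate conjugate_dist_mul mult.commute intro!: sum.cong)
qed (use assms in auto)

text \<open>
  Every nonzero vector spans the same line as the first column of some unitary matrix: complete the
  vector to a basis, orthogonalize by Gram--Schmidt, which keeps the first vector, and normalize.
\<close>

lemma unitary_completion:
  fixes v :: "complex vec"
  assumes v: "v \<in> carrier_vec n" and v0: "v \<noteq> 0\<^sub>v n"
  obtains U c where "U \<in> carrier_mat n n" "mat_adjoint U * U = 1\<^sub>m n" "col U 0 = c \<cdot>\<^sub>v v"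
proof -
  have n: "0 < n" using v v0 by (cases n) auto
  interpret cof_vec_space n "TYPE(complex)" .
  define b where "b = basis_completion v"
  define ws where "ws = gram_schmidt n b"
  note bc = basis_completion[OF v v0, folded b_def]
  from bc(6,7) n obtain vs where bv: "b = v # vs" by (cases b) auto
  from gram_schmidt_result[OF bc(2,4,5) refl, folded ws_def] bc(6)
  have ws: "set ws \<subseteq> carrier_vec n" "corthogonal ws" "length ws = n" by auto
  from gram_schmidt_hd[OF v, of vs, folded bv] have hd: "hd ws = v" unfolding ws_def .
  have ws0: "ws ! 0 = v" using hd ws(3) n by (cases ws) auto
  have wsc [simp]: "ws ! i \<in> carrier_vec n" if "i < n" for i
    using subsetD[OF ws(1) nth_mem[of i ws]] ws(3) that by simp
  have wsd [simp]: "dim_vec (ws ! i) = n" if "i < n" for i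
    using wsc[OF that] by (rule carrier_vecD)
  \<comment> \<open>Gram--Schmidt yields nonzero pairwise orthogonal vectors; \<open>c i\<close> is the inverse of the norm.\<close>
  define c where "c i = complex_of_real (1 / sqrt (Re (ws ! i \<bullet>c ws ! i)))" for i
  have cnj_c: "cnj (c i) = c i" for i by (simp add: c_def)
  define U where "U = mat n n (\<lambda>(r, i). c i * (ws ! i) $ r)"
  have norm: "c i * c i * (ws ! i \<bullet>c ws ! i) = 1" if i: "i < n" for i
  proof -
    have "ws ! i \<bullet>c ws ! i \<noteq> 0" using corthogonalD[OF ws(2), of i i] i ws(3) by simp
    moreover have "ws ! i \<bullet>c ws ! i \<ge> 0" by (rule conjugate_square_ge_0_vec)
    ultimately have "0 < Re (ws ! i \<bullet>c ws ! i)" "Im (ws ! i \<bullet>c ws ! i) = 0"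
      by (auto simp: less_eq_complex_def complex_eq_iff)
    then show ?thesis
      by (auto simp: c_def complex_eq_iff simp flip: of_real_mult)
  qed
  have "mat_adjoint U * U = 1\<^sub>m n"
  proof (rule eq_matI)
    fix i j assume "i < dim_row (1\<^sub>m n)" "j < dim_col (1\<^sub>m n)"
    then have i: "i < n" and j: "j < n" by auto
    have "(mat_adjoint U * U) $$ (i, j) = c i * c j * (ws ! j \<bullet>c ws ! i)"
      using i j by (auto simp: U_def scalar_prod_def sum_distrib_left cnj_c mult_ac intro!: sum.cong)
    also have "\<dots> = (if i = j then 1 else 0)"
      using norm[OF i] corthogonalD[OF ws(2), of j i] i j ws(3) by auto
    finally show "(mat_adjoint U * U) $$ (i, j) = 1\<^sub>m n $$ (i, j)" using i j by simp
  qed (auto simp: U_def)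
  moreover have "col U 0 = c 0 \<cdot>\<^sub>v v"
    using n v by (intro eq_vecI) (auto simp: U_def ws0)
  ultimately show thesis using that[of U "c 0"] by (auto simp: U_def)
qed

section \<open>Schur triangularization by a unitary matrix\<close>

lemma complex_mat_has_eigenvector:
  fixes A :: "complex mat"
  assumes A: "A \<in> carrier_mat n n" and n: "0 < n"
  obtains v e where "v \<in> carrier_vec n" "v \<noteq> 0\<^sub>v n" "A *\<^sub>v v = e \<cdot>\<^sub>v v"
proof -
  have "degree (char_poly A) = n" using degree_monic_char_poly[OF A] by simp
  then have "\<not> constant (poly (char_poly A))" using n by (simp add: constant_degree)
  then obtain e where "poly (char_poly A) e = 0"
    using fundamental_theorem_of_algebra by blast
  then obtain v where "eigenvector A v e"
    using eigenvalue_root_char_poly[OF A] unfolding eigenvalue_def by blast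
  then show thesis using A that unfolding eigenvector_def by auto
qed

text \<open>
  Moves the parentheses inwards: conjugating by a product of matrices is conjugating twice.
\<close>

lemma mult_mat_regroup:
  fixes X :: "'a :: semiring_1 mat"
  assumes X: "X \<in> carrier_mat n n" and Y: "Y \<in> carrier_mat n n" and A: "A \<in> carrier_mat n n"
    and Z: "Z \<in> carrier_mat n n" and W: "W \<in> carrier_mat n n"
  shows "(X * Y) * A * (Z * W) = X * (Y * A * Z) * W"
proof -
  have YA: "Y * A \<in> carrier_mat n n" and YAZ: "Y * A * Z \<in> carrier_mat n n"
    and XYA: "X * (Y * A) \<in> carrier_mat n n"
    using X Y A Z by (meson mult_carrier_mat)+
  have "(X * Y) * A * (Z * W) = X * (Y * A) * Z * W"
    unfolding assoc_mult_mat[OF X Y A] assoc_mult_mat[OF XYA Z W] ..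
  also have "\<dots> = X * (Y * A * Z) * W" unfolding assoc_mult_mat[OF X YA Z] ..
  finally show ?thesis .
qed

text \<open>
  A change of basis in the last \<open>n\<close> coordinates fixes the leading block and keeps the zero block
  below it, so the triangularization of \<open>B3\<close> can be carried out inside the larger matrix.
\<close>

lemma identity_block_conjugation:
  fixes V :: "'a :: comm_ring_1 mat"
  assumes H: "H \<in> carrier_mat n n"
    and B: "B1 \<in> carrier_mat m m" "B2 \<in> carrier_mat m n" "B3 \<in> carrier_mat n n"
    and V: "V \<in> carrier_mat n n"
  shows "four_block_mat (1\<^sub>m m) (0\<^sub>m m n) (0\<^sub>m n m) H * four_block_mat B1 B2 (0\<^sub>m n m) B3 *
      four_block_mat (1\<^sub>m m) (0\<^sub>m m n) (0\<^sub>m n m) V =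
    four_block_mat B1 (B2 * V) (0\<^sub>m n m) (H * B3 * V)"
proof -
  have HB: "H * B3 \<in> carrier_mat n n" and HBV: "H * B3 * V \<in> carrier_mat n n"
    and BV: "B2 * V \<in> carrier_mat m n" using H B V by (meson mult_carrier_mat)+
  have "four_block_mat (1\<^sub>m m) (0\<^sub>m m n) (0\<^sub>m n m) H * four_block_mat B1 B2 (0\<^sub>m n m) B3 =
      four_block_mat B1 B2 (0\<^sub>m n m) (H * B3)"
    by (subst mult_four_block_mat[OF one_carrier_mat zero_carrier_mat zero_carrier_mat H B(1,2)
          zero_carrier_mat B(3)])
      (simp add: B HB left_mult_one_mat[OF B(1)] left_mult_one_mat[OF B(2)] left_mult_zero_mat[OF B(1)]
        left_mult_zero_mat[OF B(2)] left_mult_zero_mat[OF B(3)] right_mult_zero_mat[OF H]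
        left_add_zero_mat[OF HB] right_add_zero_mat[OF B(1)] right_add_zero_mat[OF B(2)])
  also have "\<dots> * four_block_mat (1\<^sub>m m) (0\<^sub>m m n) (0\<^sub>m n m) V =
      four_block_mat B1 (B2 * V) (0\<^sub>m n m) (H * B3 * V)"
    by (subst mult_four_block_mat[OF B(1,2) zero_carrier_mat HB one_carrier_mat zero_carrier_mat
          zero_carrier_mat V])
      (simp add: B(1) HBV BV right_mult_one_mat[OF B(1)] right_mult_zero_mat[OF B(1)]
        right_mult_zero_mat[OF B(2)] left_mult_zero_mat[OF V] right_mult_zero_mat[OF HB]
        left_add_zero_mat[OF HBV] left_add_zero_mat[OF BV] right_add_zero_mat[OF B(1)])
  finally show ?thesis .
qed

text \<open>
  Induction on the size. A unitary matrix whose first column is an eigenvector brings \<open>A\<close> to a block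
  form with a zero block below the top left entry; the remaining \<open>n \<times> n\<close> block is handled by the
  induction hypothesis.
\<close>

theorem unitary_schur:
  fixes A :: "complex mat"
  assumes "A \<in> carrier_mat n n"
  shows "\<exists>U \<in> carrier_mat n n. mat_adjoint U * U = 1\<^sub>m n \<and>
    upper_triangular (mat_adjoint U * A * U)"
  using assms
proof (induction n arbitrary: A)
  case 0
  then show ?case by (intro bexI[of _ "1\<^sub>m 0"]) (auto intro: eq_matI)
next
  case (Suc n A)
  let ?N = "Suc n"
  note A = Suc.prems
  obtain v e where v: "v \<in> carrier_vec ?N" "v \<noteq> 0\<^sub>v ?N" and ev: "A *\<^sub>v v = e \<cdot>\<^sub>v v"
    using complex_mat_has_eigenvector[OF A] by blast
  obtain U c where U: "U \<in> carrier_mat ?N ?N" "mat_adjoint U * U = 1\<^sub>m ?N"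
    and col: "col U 0 = c \<cdot>\<^sub>v v"
    using unitary_completion[OF v] .
  define B where "B = mat_adjoint U * A * U"
  have Uh: "mat_adjoint U \<in> carrier_mat ?N ?N" using U(1) by simp
  have B: "B \<in> carrier_mat ?N ?N" using A U Uh unfolding B_def by (meson mult_carrier_mat)
  have "dim_vec (col U 0) = ?N" using U(1) by simp
  then have col0: "col U 0 \<in> carrier_vec ?N" by (rule carrier_vecI)
  have "col B 0 = mat_adjoint U *\<^sub>v (A *\<^sub>v col U 0)"
    unfolding B_def using A U(1) Uh
    by (subst col_mult2[of _ ?N ?N _ ?N]) (auto intro!: assoc_mult_mat_vec[OF Uh A col0])
  also have "A *\<^sub>v col U 0 = e \<cdot>\<^sub>v col U 0"
    unfolding col using A v(1) ev by (simp add: mult_mat_vec[of _ ?N ?N] smult_smult_assoc mult.commute)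
  also have "mat_adjoint U *\<^sub>v (e \<cdot>\<^sub>v col U 0) = e \<cdot>\<^sub>v col (mat_adjoint U * U) 0"
    using U(1) Uh by (simp add: mult_mat_vec[OF Uh col0] col_mult2[of _ ?N ?N _ ?N])
  \<comment> \<open>The columns of \<open>U\<close> are orthonormal, so the new matrix has the scaled unit vector in front.\<close>
  finally have colB: "col B 0 = e \<cdot>\<^sub>v unit_vec ?N 0" using U(2) by simp
  obtain B1 B2 B0 B3 where split: "split_block B 1 1 = (B1, B2, B0, B3)"
    by (cases "split_block B 1 1") auto
  have "dim_row B = 1 + n" "dim_col B = 1 + n" using B by auto
  note sb = split_block[OF split this]
  have B0: "B0 = 0\<^sub>m n 1"
  proof (rule eq_matI)
    fix i j assume ij: "i < dim_row (0\<^sub>m n 1)" "j < dim_col (0\<^sub>m n 1)"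
    then have "B0 $$ (i, j) = col B 0 $ Suc i"
      using split B by (auto simp: split_block_def Let_def)
    also have "\<dots> = 0" unfolding colB using ij by simp
    finally show "B0 $$ (i, j) = 0\<^sub>m n 1 $$ (i, j)" using ij by simp
  qed (use sb in auto)
  from Suc.IH[OF sb(4)] obtain V where V: "V \<in> carrier_mat n n" "mat_adjoint V * V = 1\<^sub>m n"
    and ut: "upper_triangular (mat_adjoint V * B3 * V)" by blast
  have Vh: "mat_adjoint V \<in> carrier_mat n n" using V(1) by simp
  \<comment> \<open>Extend \<open>V\<close> so that it fixes the eigenvector found first.\<close>
  define W where "W = four_block_mat (1\<^sub>m 1) (0\<^sub>m 1 n) (0\<^sub>m n 1) V"
  have W: "W \<in> carrier_mat ?N ?N"
    using four_block_carrier_mat[OF one_carrier_mat V(1), of 1 "0\<^sub>m 1 n" "0\<^sub>m n 1"] by (simp add: W_def)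
  have Wh: "mat_adjoint W = four_block_mat (1\<^sub>m 1) (0\<^sub>m 1 n) (0\<^sub>m n 1) (mat_adjoint V)"
    using V(1) by (intro eq_matI) (auto simp: W_def)
  have Whc: "mat_adjoint W \<in> carrier_mat ?N ?N" using W by simp
  have WW: "mat_adjoint W * W = 1\<^sub>m ?N"
    using identity_block_conjugation[OF Vh one_carrier_mat zero_carrier_mat one_carrier_mat V(1), of 1] V Vh
    unfolding Wh unfolding W_def four_block_one_mat by (simp add: left_mult_zero_mat[OF V(1)])
  have UW: "mat_adjoint (U * W) = mat_adjoint W * mat_adjoint U"
    using U(1) W by (rule mat_adjoint_mult)
  have "mat_adjoint W * B * W = four_block_mat B1 (B2 * V) (0\<^sub>m n 1) (mat_adjoint V * B3 * V)"
    unfolding Wh sb(5) B0 unfolding W_def by (rule identity_block_conjugation[OF Vh sb(1,2,4) V(1)])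
  moreover have "upper_triangular (four_block_mat B1 (B2 * V) (0\<^sub>m n 1) (mat_adjoint V * B3 * V))"
    using sb(1,4) V Vh ut by (intro upper_triangular_four_block[of _ 1]) auto
  moreover have "mat_adjoint (U * W) * A * (U * W) = mat_adjoint W * B * W"
    unfolding UW B_def by (rule mult_mat_regroup[OF Whc Uh A U(1) W])
  moreover have "mat_adjoint (U * W) * (U * W) = 1\<^sub>m ?N"
    using mult_mat_regroup[OF Whc Uh one_carrier_mat U(1) W]
    unfolding UW right_mult_one_mat[OF Uh] right_mult_one_mat[OF mult_carrier_mat[OF Whc Uh]]
      U(2) right_mult_one_mat[OF Whc] WW .
  ultimately show ?case using U(1) W by (intro bexI[of _ "U * W"]) auto
qed

section \<open>The discrete Fourier transform of a sequence\<close>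

definition dft_root :: "nat \<Rightarrow> complex" where
  "dft_root p = cis (2 * pi / p)"

lemma dft_root_power_self: "0 < p \<Longrightarrow> dft_root p ^ p = 1"
  by (simp add: dft_root_def DeMoivre)

lemma dft_root_mult_cnj [simp]: "dft_root p * cnj (dft_root p) = 1"
  by (simp add: dft_root_def cis_cnj cis_mult)

lemma dft_root_power_mod:
  assumes "0 < p" "a mod p = b mod p"
  shows "dft_root p ^ (a * q) = dft_root p ^ (b * q)"
proof -
  have "dft_root p ^ a = dft_root p ^ (a mod p)" for a
  proof -
    have "dft_root p ^ a = dft_root p ^ (p * (a div p) + a mod p)" by simp
    also have "\<dots> = dft_root p ^ (a mod p)"
      unfolding power_add power_mult dft_root_power_self[OF assms(1)] by simp
    finally show ?thesis .
  qed
  then show ?thesis using assms(2) by (metis power_mult)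
qed

text \<open>
  A geometric sum with ratio \<open>w\<^sup>l / w\<^sup>k\<close>. This ratio is a \<open>p\<close>-th root of unity and differs
  from 1 for \<open>k \<noteq> l\<close>, as the powers of \<open>w\<close> below \<open>p\<close> are distinct.
\<close>

lemma dft_root_orthogonal:
  assumes "k < p" "l < p"
  shows "(\<Sum>q<p. cnj (dft_root p) ^ (k * q) * dft_root p ^ (l * q)) = (if k = l then of_nat p else 0)"
proof -
  let ?w = "dft_root p"
  define x where "x = cnj ?w ^ k * ?w ^ l"
  have p: "0 < p" using assms by simp
  have cancel: "cnj ?w ^ k * ?w ^ k = 1" for k
    by (simp add: mult.commute flip: power_mult_distrib)
  have sum: "(\<Sum>q<p. cnj ?w ^ (k * q) * ?w ^ (l * q)) = (\<Sum>q<p. x ^ q)"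
    by (simp add: x_def power_mult power_mult_distrib)
  show ?thesis
  proof (cases "k = l")
    case True
    then show ?thesis unfolding sum using cancel[of k] by (simp add: x_def)
  next
    case False
    have inj: "inj_on (\<lambda>k. cis (2 * pi * real k / real p)) {..<p}"
      using bij_betw_roots_unity[OF p] by (rule bij_betw_imp_inj_on)
    have "?w ^ k \<noteq> ?w ^ l"
      using inj_onD[OF inj, of k l] False assms by (auto simp: dft_root_def DeMoivre mult_ac)
    moreover have "?w ^ k * x = ?w ^ l"
      using cancel[of k] by (simp add: x_def mult_ac)
    ultimately have "x \<noteq> 1" by auto
    moreover have "x ^ p = 1"
      by (simp add: x_def power_mult_distrib dft_root_power_self[OF p]
          power_mult[symmetric] mult.commute[of _ p])
        (simp add: power_mult dft_root_power_self[OF p] flip: complex_cnj_power)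
    ultimately show ?thesis unfolding sum using False by (simp add: geometric_sum)
  qed
qed

lemma dft_inversion:
  assumes "k < p"
  shows "(\<Sum>q<p. cnj (dft_root p) ^ (k * q) * (\<Sum>l<p. dft_root p ^ (l * q) * f l)) = of_nat p * f k"
proof -
  let ?w = "dft_root p"
  have "(\<Sum>q<p. cnj ?w ^ (k * q) * (\<Sum>l<p. ?w ^ (l * q) * f l))
      = (\<Sum>l<p. (\<Sum>q<p. cnj ?w ^ (k * q) * ?w ^ (l * q)) * f l)"
    unfolding sum_distrib_left sum_distrib_right by (subst sum.swap) (simp add: mult_ac)
  also have "\<dots> = (\<Sum>l<p. if k = l then of_nat p * f l else 0)"
    using assms by (intro sum.cong) (auto simp: dft_root_orthogonal)
  also have "\<dots> = of_nat p * f k" using assms by simp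
  finally show ?thesis .
qed

text \<open>
  The other composition of the two transforms. Conjugation exchanges their kernels.
\<close>

lemma dft_inversion':
  assumes "k < p"
  shows "(\<Sum>q<p. dft_root p ^ (q * k) * (\<Sum>l<p. cnj (dft_root p) ^ (q * l) * f l)) = of_nat p * f k"
proof -
  from dft_inversion[OF assms, of "\<lambda>l. cnj (f l)"]
  have "cnj (\<Sum>q<p. cnj (dft_root p) ^ (k * q) * (\<Sum>l<p. dft_root p ^ (l * q) * cnj (f l)))
      = of_nat p * f k" by simp
  then show ?thesis by (simp add: mult.commute[of k] mult.commute[of _ "_ :: nat"])
qed

text \<open>
  The convolution theorem: for fixed \<open>l\<close>, the substitution \<open>k = h + l\<close> modulo \<open>p\<close> splits the
  kernel into a factor for \<open>a\<close> and a factor for \<open>b\<close>. Products of roots of unity depend only on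
  the exponent modulo \<open>p\<close>, so that the cyclic wrap-around is harmless.
\<close>

lemma dft_cyclic_convolution:
  assumes p: "0 < p"
  shows "(\<Sum>k<p. dft_root p ^ (k * q) * (\<Sum>l<p. a ((k + p - l) mod p) * b l)) =
    (\<Sum>k<p. dft_root p ^ (k * q) * a k) * (\<Sum>l<p. dft_root p ^ (l * q) * b l)"
proof -
  let ?w = "dft_root p"
  have shift: "(\<Sum>k<p. ?w ^ (k * q) * a ((k + p - l) mod p)) = ?w ^ (l * q) * (\<Sum>h<p. ?w ^ (h * q) * a h)"
    if l: "l < p" for l
  proof -
    have "(\<Sum>k<p. ?w ^ (k * q) * a ((k + p - l) mod p)) = (\<Sum>h<p. ?w ^ ((h + l) * q) * a h)"
    proof (rule sum.reindex_bij_witness[where i = "\<lambda>h. (h + l) mod p" and j = "\<lambda>k. (k + p - l) mod p"])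
      fix k assume k: "k \<in> {..<p}"
      have eq: "((k + p - l) mod p + l) mod p = k"
        using k l by (simp add: mod_add_left_eq)
      then show "((k + p - l) mod p + l) mod p = k" .
      show "?w ^ (((k + p - l) mod p + l) * q) * a ((k + p - l) mod p) =
          ?w ^ (k * q) * a ((k + p - l) mod p)"
        using dft_root_power_mod[OF p, of "(k + p - l) mod p + l" k q] eq k by simp
    next
      fix h assume h: "h \<in> {..<p}"
      show "((h + l) mod p + p - l) mod p = h"
      proof -
        have "((h + l) mod p + p - l) mod p = ((h + l) mod p + (p - l)) mod p" using l by simp
        also have "\<dots> = (h + l + (p - l)) mod p" by (rule mod_add_left_eq)
        finally show ?thesis using h l by simp
      qed
    qed (use p in auto)
    also have "\<dots> = ?w ^ (l * q) * (\<Sum>h<p. ?w ^ (h * q) * a h)"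
      unfolding sum_distrib_left by (intro sum.cong refl) (simp add: add_mult_distrib power_add mult_ac[where ?'a = complex])
    finally show ?thesis .
  qed
  have "(\<Sum>k<p. ?w ^ (k * q) * (\<Sum>l<p. a ((k + p - l) mod p) * b l)) =
      (\<Sum>l<p. (\<Sum>k<p. ?w ^ (k * q) * a ((k + p - l) mod p)) * b l)"
    unfolding sum_distrib_left sum_distrib_right by (subst sum.swap) (simp add: mult_ac)
  also have "\<dots> = (\<Sum>l<p. ?w ^ (l * q) * (\<Sum>h<p. ?w ^ (h * q) * a h) * b l)"
    using shift by simp
  finally show ?thesis by (simp add: sum_distrib_left mult_ac)
qed

text \<open>
  The index \<open>(p - k) mod p\<close> is \<open>-k\<close> modulo \<open>p\<close>, and conjugating a root of unity also negates
  its exponent.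
\<close>

lemma dft_cyclic_reversal:
  assumes p: "0 < p"
  shows "(\<Sum>k<p. dft_root p ^ (k * q) * cnj (a ((p - k) mod p))) = cnj (\<Sum>k<p. dft_root p ^ (k * q) * a k)"
proof -
  let ?w = "dft_root p"
  have inv: "(p - (p - k) mod p) mod p = k" if "k < p" for k
    using that by (cases "k = 0") auto
  have "(\<Sum>k<p. ?w ^ (k * q) * cnj (a ((p - k) mod p))) = (\<Sum>k<p. cnj ?w ^ (k * q) * cnj (a k))"
  proof (rule sum.reindex_bij_witness[where i = "\<lambda>k. (p - k) mod p" and j = "\<lambda>k. (p - k) mod p"])
    fix k assume k: "k \<in> {..<p}"
    let ?h = "(p - k) mod p"
    have "(?h + k) mod p = 0 mod p" using k by (cases "k = 0") auto
    from dft_root_power_mod[OF p this, of q]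
    have "?w ^ (?h * q) * ?w ^ (k * q) = 1" by (simp add: add_mult_distrib power_add)
    moreover have "cnj ?w ^ (?h * q) * ?w ^ (?h * q) = 1"
      by (simp add: mult.commute flip: power_mult_distrib)
    ultimately have "cnj ?w ^ (?h * q) = ?w ^ (k * q)"
      by (metis mult.assoc mult.left_neutral mult.right_neutral)
    then show "cnj ?w ^ (?h * q) * cnj (a ?h) = ?w ^ (k * q) * cnj (a ?h)" by simp
  qed (use p inv in auto)
  then show ?thesis by simp
qed

section \<open>The Fourier transform of a tensor\<close>

text \<open>
  The transform acts entrywise along the third dimension. Its values are kept as a function from
  frequencies to matrices, not as a tensor, because they are multiplied as matrices. The factor
  \<open>1 / p\<close> sits entirely in the inverse: this makes the transform multiplicative without
  correction factors.
\<close>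

definition t_dft :: "tensor \<Rightarrow> nat \<Rightarrow> complex mat" where
  "t_dft A q = mat (t_rows A) (t_cols A)
     (\<lambda>ij. \<Sum>k<length A. dft_root (length A) ^ (k * q) * (A ! k) $$ ij)"

definition t_idft :: "nat \<Rightarrow> nat \<Rightarrow> nat \<Rightarrow> (nat \<Rightarrow> complex mat) \<Rightarrow> tensor" where
  "t_idft m n p F = map (\<lambda>k. mat m n
     (\<lambda>ij. (\<Sum>q<p. cnj (dft_root p) ^ (k * q) * F q $$ ij) / of_nat p)) [0..<p]"

lemma tensor_carrierI:
  assumes "length A = p" "\<And>k. k < p \<Longrightarrow> A ! k \<in> carrier_mat m n"
  shows "A \<in> tensor_carrier m n p"
  using assms by (auto simp: tensor_carrier_def in_set_conv_nth)

lemma t_idft_carrier [simp]: "t_idft m n p F \<in> tensor_carrier m n p"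
  by (rule tensor_carrierI) (simp_all add: t_idft_def)

lemma t_dft_carrier:
  assumes "A \<in> tensor_carrier m n p" "0 < p"
  shows "t_dft A q \<in> carrier_mat m n"
  using tensor_carrier_dims[OF assms] by (simp add: t_dft_def)

lemma t_dft_index:
  assumes "A \<in> tensor_carrier m n p" "0 < p" "i < m" "j < n"
  shows "t_dft A q $$ (i, j) = (\<Sum>k<p. dft_root p ^ (k * q) * (A ! k) $$ (i, j))"
  using tensor_carrier_dims[OF assms(1,2)] assms(3,4) by (simp add: t_dft_def)

lemma t_dft_idft:
  assumes p: "0 < p" and q: "q < p" and F: "F q \<in> carrier_mat m n"
  shows "t_dft (t_idft m n p F) q = F q"
proof (rule eq_matI)
  note d = t_dft_carrier[OF t_idft_carrier[of m n p F] p, of q]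
  show "dim_row (t_dft (t_idft m n p F) q) = dim_row (F q)"
    "dim_col (t_dft (t_idft m n p F) q) = dim_col (F q)" using d F by auto
  fix i j assume "i < dim_row (F q)" "j < dim_col (F q)"
  then have ij: "i < m" "j < n" using F by auto
  have "t_dft (t_idft m n p F) q $$ (i, j) =
      (\<Sum>k<p. dft_root p ^ (k * q) * (\<Sum>l<p. cnj (dft_root p) ^ (k * l) * F l $$ (i, j))) / of_nat p"
    unfolding t_dft_index[OF t_idft_carrier p ij] sum_divide_distrib
    using ij by (intro sum.cong) (auto simp: t_idft_def)
  then show "t_dft (t_idft m n p F) q $$ (i, j) = F q $$ (i, j)"
    using p by (simp add: dft_inversion'[OF q])
qed

lemma t_idft_dft:
  assumes A: "A \<in> tensor_carrier m n p" and p: "0 < p"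
  shows "t_idft m n p (t_dft A) = A"
proof (rule nth_equalityI)
  note d = tensor_carrier_dims[OF A p]
  show "length (t_idft m n p (t_dft A)) = length A" by (simp add: t_idft_def d)
  fix k assume "k < length (t_idft m n p (t_dft A))"
  then have k: "k < p" by (simp add: t_idft_def)
  show "t_idft m n p (t_dft A) ! k = A ! k"
    using d(4)[OF k] k p
    by (intro eq_matI) (auto simp: t_idft_def t_dft_index[OF A p] dft_inversion)
qed

text \<open>
  The transform has a left inverse, so identities between tensors can be checked frequency by
  frequency.
\<close>

lemma t_dft_eqI:
  assumes "A \<in> tensor_carrier m n p" "B \<in> tensor_carrier m n p" and p: "0 < p"
    and eq: "\<And>q. q < p \<Longrightarrow> t_dft A q = t_dft B q"
  shows "A = B"
proof -
  have "t_idft m n p (t_dft A) = t_idft m n p (t_dft B)"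
    using eq by (simp add: t_idft_def)
  then show ?thesis using assms by (simp add: t_idft_dft)
qed

lemma t_prod_carrier:
  assumes A: "A \<in> tensor_carrier m n p" and B: "B \<in> tensor_carrier n r p" and p: "0 < p"
  shows "A *\<^sub>t B \<in> tensor_carrier m r p"
  by (rule tensor_carrierI)
    (simp_all add: t_prod_def t_fold_def t_unfold_def Let_def
      tensor_carrier_dims[OF A p] tensor_carrier_dims[OF B p])

text \<open>
  The block circulant definition of the T-product as a cyclic convolution of slices. The summation
  index \<open>t < n * p\<close> over a row of the block circulant matrix is split into the block
  \<open>l = t div n\<close> and the position \<open>s = t mod n\<close> within it.
\<close>

lemma t_prod_nth_index:
  assumes A: "A \<in> tensor_carrier m n p" and B: "B \<in> tensor_carrier n r p"
    and k: "k < p" and i: "i < m" and j: "j < r"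
  shows "(A *\<^sub>t B) ! k $$ (i, j) =
    (\<Sum>s<n. \<Sum>l<p. (A ! ((k + p - l) mod p)) $$ (i, s) * (B ! l) $$ (s, j))"
proof -
  have p: "0 < p" using k by simp
  note dA = tensor_carrier_dims[OF A p] and dB = tensor_carrier_dims[OF B p]
  have bnd: "k * m + i < m * p"
  proof -
    have "k * m + i < Suc k * m" using i by simp
    also have "\<dots> \<le> p * m" using k by (intro mult_le_mono1) simp
    finally show ?thesis by (simp add: mult.commute)
  qed
  let ?g = "\<lambda>t. (A ! ((k + p - t div n) mod p)) $$ (i, t mod n) * (B ! (t div n)) $$ (t mod n, j)"
  have idx: "l * n + s < n * p" if "s < n" "l < p" for l s
  proof -
    have "l * n + s < Suc l * n" using that by simp
    also have "\<dots> \<le> p * n" using that by (intro mult_le_mono1) simp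
    finally show ?thesis by (simp add: mult.commute)
  qed
  have "(A *\<^sub>t B) ! k $$ (i, j) = (\<Sum>t<n * p. ?g t)"
    using k i j bnd
    by (simp add: t_prod_def t_fold_def t_unfold_def t_bcirc_def Let_def dA dB scalar_prod_def
        atLeast0LessThan)
  also have "(\<Sum>t<n * p. ?g t) = (\<Sum>(s, l)\<in>{..<n} \<times> {..<p}. (A ! ((k + p - l) mod p)) $$ (i, s) * (B ! l) $$ (s, j))"
    by (rule sum.reindex_bij_witness[where i = "\<lambda>(s, l). l * n + s" and j = "\<lambda>t. (t mod n, t div n)"])
      (auto simp: less_mult_imp_div_less mult.commute idx intro!: mod_less_divisor gr0I)
  finally show ?thesis by (simp add: sum.cartesian_product)
qed

lemma t_dft_prod:
  assumes A: "A \<in> tensor_carrier m n p" and B: "B \<in> tensor_carrier n r p" and p: "0 < p"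
  shows "t_dft (A *\<^sub>t B) q = t_dft A q * t_dft B q"
proof (rule eq_matI)
  note AB = t_prod_carrier[OF A B p]
  note dims = t_dft_carrier[OF A p, of q] t_dft_carrier[OF B p, of q] t_dft_carrier[OF AB p, of q]
  show "dim_row (t_dft (A *\<^sub>t B) q) = dim_row (t_dft A q * t_dft B q)"
    "dim_col (t_dft (A *\<^sub>t B) q) = dim_col (t_dft A q * t_dft B q)" using dims by auto
  fix i j assume "i < dim_row (t_dft A q * t_dft B q)" "j < dim_col (t_dft A q * t_dft B q)"
  then have i: "i < m" and j: "j < r" using dims by auto
  let ?w = "dft_root p"
  have "t_dft (A *\<^sub>t B) q $$ (i, j) = (\<Sum>k<p. ?w ^ (k * q) *
      (\<Sum>s<n. \<Sum>l<p. (A ! ((k + p - l) mod p)) $$ (i, s) * (B ! l) $$ (s, j)))"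
    using i j by (simp add: t_dft_index[OF AB p] t_prod_nth_index[OF A B])
  also have "\<dots> = (\<Sum>s<n. \<Sum>k<p. ?w ^ (k * q) *
      (\<Sum>l<p. (A ! ((k + p - l) mod p)) $$ (i, s) * (B ! l) $$ (s, j)))"
    by (subst sum.swap) (simp add: sum_distrib_left)
  also have "\<dots> = (\<Sum>s<n. t_dft A q $$ (i, s) * t_dft B q $$ (s, j))"
    using dft_cyclic_convolution[OF p, of q "\<lambda>k. (A ! k) $$ (i, s)" "\<lambda>l. (B ! l) $$ (s, j)" for s] i j
    by (simp add: t_dft_index[OF A p] t_dft_index[OF B p])
  also have "\<dots> = (t_dft A q * t_dft B q) $$ (i, j)"
    using i j dims by (simp add: scalar_prod_def atLeast0LessThan)
  finally show "t_dft (A *\<^sub>t B) q $$ (i, j) = (t_dft A q * t_dft B q) $$ (i, j)" .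
qed

lemma t_dft_adjoint:
  assumes A: "A \<in> tensor_carrier m n p" and p: "0 < p"
  shows "t_dft (t_adjoint A) q = mat_adjoint (t_dft A q)"
proof (rule eq_matI)
  note H = t_adjoint_carrier[OF A]
  note dims = t_dft_carrier[OF A p, of q] t_dft_carrier[OF H p, of q]
  note d = tensor_carrier_dims[OF A p]
  show "dim_row (t_dft (t_adjoint A) q) = dim_row (mat_adjoint (t_dft A q))"
    "dim_col (t_dft (t_adjoint A) q) = dim_col (mat_adjoint (t_dft A q))" using dims by auto
  fix i j assume "i < dim_row (mat_adjoint (t_dft A q))" "j < dim_col (mat_adjoint (t_dft A q))"
  then have i: "i < n" and j: "j < m" using dims by auto
  have entry: "t_adjoint A ! k $$ (i, j) = cnj ((A ! ((p - k) mod p)) $$ (j, i))" if "k < p" for k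
  proof -
    have "A ! ((p - k) mod p) \<in> carrier_mat m n" using d(4) p by simp
    then show ?thesis using that i j t_adjoint_nth[of k A] by (simp add: d(1))
  qed
  show "t_dft (t_adjoint A) q $$ (i, j) = mat_adjoint (t_dft A q) $$ (i, j)"
    using i j dims dft_cyclic_reversal[OF p, of q "\<lambda>k. (A ! k) $$ (j, i)"]
    by (simp add: t_dft_index[OF A p] t_dft_index[OF H p] entry)
qed

lemma t_one_carrier [simp]: "t_one n p \<in> tensor_carrier n n p"
  by (rule tensor_carrierI) (simp_all add: t_one_def)

lemma t_dft_one:
  assumes p: "0 < p"
  shows "t_dft (t_one n p) q = 1\<^sub>m n"
proof (rule eq_matI)
  fix i j assume "i < dim_row (1\<^sub>m n)" "j < dim_col (1\<^sub>m n)"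
  then have ij: "i < n" "j < n" by auto
  have "t_dft (t_one n p) q $$ (i, j) =
      (\<Sum>k<p. if k = 0 then 1\<^sub>m n $$ (i, j) else 0)"
    unfolding t_dft_index[OF t_one_carrier p ij]
    using ij by (intro sum.cong) (auto simp: t_one_def)
  then show "t_dft (t_one n p) q $$ (i, j) = 1\<^sub>m n $$ (i, j)" using p by simp
qed (use t_dft_carrier[OF t_one_carrier p, of n q] in auto)

section \<open>Unitary tensors and the Schur factorization\<close>

text \<open>
  The adjoint of a unitary tensor is an inverse by definition. It is the only one: on the transform,
  a left inverse \<open>R\<close> of a matrix \<open>Q\<close> with right inverse \<open>H\<close> satisfies
  \<open>R = R * (Q * H) = (R * Q) * H = H\<close>.
\<close>

lemma t_inv_unitary:
  assumes Q: "t_unitary n p Q" and p: "0 < p"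
  shows "t_inv n p Q = t_adjoint Q"
proof -
  have Qc: "Q \<in> tensor_carrier n n p" and Q1: "t_adjoint Q *\<^sub>t Q = t_one n p"
    and Q2: "Q *\<^sub>t t_adjoint Q = t_one n p" using Q by (auto simp: t_unitary_def)
  note Hc = t_adjoint_carrier[OF Qc]
  have "R = t_adjoint Q" if R: "R \<in> tensor_carrier n n p" "R *\<^sub>t Q = t_one n p" for R
  proof (rule t_dft_eqI[OF R(1) Hc p])
    fix q
    let ?R = "t_dft R q" and ?Q = "t_dft Q q" and ?H = "t_dft (t_adjoint Q) q"
    have c: "?R \<in> carrier_mat n n" "?Q \<in> carrier_mat n n" "?H \<in> carrier_mat n n"
      using t_dft_carrier R(1) Qc Hc p by blast+
    have "?R * ?Q = 1\<^sub>m n" using t_dft_prod[OF R(1) Qc p, of q] R(2) p by (simp add: t_dft_one)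
    moreover have "?Q * ?H = 1\<^sub>m n" using t_dft_prod[OF Qc Hc p, of q] Q2 p by (simp add: t_dft_one)
    moreover have "?R * ?Q * ?H = ?R * (?Q * ?H)" using c by (rule assoc_mult_mat)
    ultimately show "?R = ?H" using c by simp
  qed
  then show ?thesis unfolding t_inv_def using Hc Q1 Q2 by (intro the_equality conjI) (assumption | blast)+
qed

text \<open>
  A one-sided condition suffices because a one-sided inverse of a square matrix is two-sided.
\<close>

lemma t_unitary_iff_dft:
  assumes Q: "Q \<in> tensor_carrier n n p" and p: "0 < p"
  shows "t_unitary n p Q \<longleftrightarrow> (\<forall>q<p. t_dft Q q * mat_adjoint (t_dft Q q) = 1\<^sub>m n)"
proof
  note H = t_adjoint_carrier[OF Q]
  assume "t_unitary n p Q"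
  then have "Q *\<^sub>t t_adjoint Q = t_one n p" by (simp add: t_unitary_def)
  then show "\<forall>q<p. t_dft Q q * mat_adjoint (t_dft Q q) = 1\<^sub>m n"
    using t_dft_prod[OF Q H p] t_dft_adjoint[OF Q p] t_dft_one[OF p] by metis
next
  note H = t_adjoint_carrier[OF Q]
  assume r: "\<forall>q<p. t_dft Q q * mat_adjoint (t_dft Q q) = 1\<^sub>m n"
  have l: "mat_adjoint (t_dft Q q) * t_dft Q q = 1\<^sub>m n" if "q < p" for q
    using mat_mult_left_right_inverse[OF t_dft_carrier[OF Q p]
        mat_adjoint_carrier[OF t_dft_carrier[OF Q p]]] r that by blast
  have "t_adjoint Q *\<^sub>t Q = t_one n p"
    by (rule t_dft_eqI[OF t_prod_carrier[OF H Q p] t_one_carrier p])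
      (simp add: t_dft_prod[OF H Q p] t_dft_adjoint[OF Q p] t_dft_one[OF p] l)
  moreover have "Q *\<^sub>t t_adjoint Q = t_one n p"
    by (rule t_dft_eqI[OF t_prod_carrier[OF Q H p] t_one_carrier p])
      (simp add: t_dft_prod[OF Q H p] t_dft_adjoint[OF Q p] t_dft_one[OF p] r)
  ultimately show "t_unitary n p Q" using Q by (simp add: t_unitary_def)
qed

lemma inverse_conjugation_cancel:
  fixes U :: "'a :: comm_ring_1 mat"
  assumes "U \<in> carrier_mat n n" "H \<in> carrier_mat n n" "B \<in> carrier_mat n n" "U * H = 1\<^sub>m n"
  shows "U * (H * B * U) * H = B"
proof -
  have "U * (H * B * U) * H = (U * H) * B * (U * H)"
    using mult_mat_regroup[OF assms(1,2,3,1,2)] by simp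
  then show ?thesis using assms(3,4) by simp
qed

lemma F_upper_triangular_idft:
  assumes "\<And>q. q < p \<Longrightarrow> F q \<in> carrier_mat n n" "\<And>q. q < p \<Longrightarrow> upper_triangular (F q)"
  shows "F_upper_triangular (t_idft n n p F)"
proof -
  have "F q $$ (i, j) = 0" if "q < p" "j < i" "i < n" for q i j
    using assms that by (metis carrier_matD(1) upper_triangularD)
  then show ?thesis by (auto simp: F_upper_triangular_def t_idft_def intro!: upper_triangularI)
qed

theorem theorem11:
  fixes A :: tensor and n p :: nat
  assumes "0 < n" and "0 < p" and "A \<in> tensor_carrier n n p"
  shows "\<exists>Q T. Q \<in> tensor_carrier n n p \<and> t_unitary n p Q \<and>
           T \<in> tensor_carrier n n p \<and> F_upper_triangular T \<and>
           A = t_inv n p Q *\<^sub>t T *\<^sub>t Q"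
proof -
  note p = assms(2) and A = assms(3)
  have "\<forall>q. \<exists>U \<in> carrier_mat n n. mat_adjoint U * U = 1\<^sub>m n \<and>
      upper_triangular (mat_adjoint U * t_dft A q * U)"
    using unitary_schur[OF t_dft_carrier[OF A p]] by blast
  then obtain U where U: "U q \<in> carrier_mat n n" and UU: "mat_adjoint (U q) * U q = 1\<^sub>m n"
    and ut: "upper_triangular (mat_adjoint (U q) * t_dft A q * U q)" for q
    by metis
  define S where "S q = mat_adjoint (U q) * t_dft A q * U q" for q
  define Q where "Q = t_idft n n p (\<lambda>q. mat_adjoint (U q))"
  define T where "T = t_idft n n p S"
  have Uh: "mat_adjoint (U q) \<in> carrier_mat n n" for q using U by simp
  have Ac: "t_dft A q \<in> carrier_mat n n" for q using t_dft_carrier[OF A p] .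
  have S: "S q \<in> carrier_mat n n" for q using U Uh Ac unfolding S_def by (meson mult_carrier_mat)
  have Qc: "Q \<in> tensor_carrier n n p" and Tc: "T \<in> tensor_carrier n n p"
    by (simp_all add: Q_def T_def)
  note Hc = t_adjoint_carrier[OF Qc]
  have dQ: "t_dft Q q = mat_adjoint (U q)" and dT: "t_dft T q = S q" if "q < p" for q
    unfolding Q_def T_def by (intro t_dft_idft[OF p that] Uh S)+
  have unitary: "t_unitary n p Q"
    unfolding t_unitary_iff_dft[OF Qc p] by (simp add: dQ UU)
  have UU': "U q * mat_adjoint (U q) = 1\<^sub>m n" for q
    using mat_mult_left_right_inverse[OF Uh U UU] .
  have "A = t_adjoint Q *\<^sub>t T *\<^sub>t Q"
  proof (rule t_dft_eqI[OF A t_prod_carrier[OF t_prod_carrier[OF Hc Tc p] Qc p] p])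
    fix q assume q: "q < p"
    have "t_dft (t_adjoint Q *\<^sub>t T *\<^sub>t Q) q = U q * S q * mat_adjoint (U q)"
      by (simp add: t_dft_prod[OF t_prod_carrier[OF Hc Tc p] Qc p] t_dft_prod[OF Hc Tc p]
          t_dft_adjoint[OF Qc p] dQ[OF q] dT[OF q])
    also have "\<dots> = t_dft A q"
      unfolding S_def by (rule inverse_conjugation_cancel[OF U Uh Ac UU'])
    finally show "t_dft A q = t_dft (t_adjoint Q *\<^sub>t T *\<^sub>t Q) q" ..
  qed
  moreover have "F_upper_triangular T"
    unfolding T_def using S ut by (intro F_upper_triangular_idft) (auto simp: S_def)
  ultimately show ?thesis
    using Qc Tc unitary unfolding t_inv_unitary[OF unitary p, symmetric] by blast
qed

end
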